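(* For every positive integer $d$, $$G_d\supseteq\bigcup_{j=1}^{d-1}\left(G_j+\binom{d-j}{2}\right).$$
   Context: Binomial expansion: for positive integers $a,t$ write uniquely $a=\binom{k(t)}{t}+\binom{k(t-1)}{t-1}+\cdots+\binom{k(j)}{j}$ with $k(t)>k(t-1)>\cdots>k(j)\geq j\geq 1$, and set $a^{\langle t\rangle}:=\binom{k(t)+1}{t+1}+\binom{k(t-1)+1}{t}+\cdots+\binom{k(j)+1}{j+1}$; also $0^{\langle t\rangle}:=0$. Binomials satisfy $\binom{n}{m}=0$ for $n<m$. A function $\mathsf{h}:\mathbb{N}\to\mathbb{N}$ is an O-sequence if $\mathsf{h}(0)=1$ and $\mathsf{h}(t+1)\leq \mathsf{h}(t)^{\langle t\rangle}$ for every $t\geq 1$. It is finite if $\mathsf{h}(t)=0$ for some $t$ (and then for all larger arguments); a finite O-sequence is written $(h_0,\ldots,h_{s-1})$ with $h_{s-1}\neq 0$, $s$ is its length, and $\sum_{i=0}^{s-1}h_i$ is its multiplicity. The genus of $\mathsf{h}=(h_0,\ldots,h_{s-1})$ is $g(\mathsf{h}):=\sum_{j=2}^{s-1}(j-1)h_j$. $G_d$ is the set of all $g(\mathsf{h})$ for $\mathsf{h}$ a finite O-sequence of multiplicity $d$; equivalently, the set of arithmetic genera of arithmetically Cohen-Macaulay projective curves of degree $d$. For a set $G$ of integers and a non-negative integer $a$, $G+a:=\{x+a\mid x\in G\}$. *)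

theory Defs
  imports Complex_Main
begin

text \<open>The binomial expansion
  \<open>a = (k t choose t) + (k (t-1) choose (t-1)) + \<dots> + (k j choose j)\<close>
  with \<open>k t > \<dots> > k j \<ge> j \<ge> 1\<close>.
  Values of \<open>k\<close> outside \<open>{j..t}\<close> are irrelevant.\<close>

definition binomial_expansion :: "nat \<Rightarrow> nat \<Rightarrow> nat \<Rightarrow> (nat \<Rightarrow> nat) \<Rightarrow> bool" where
  "binomial_expansion a t j k \<longleftrightarrow>
     1 \<le> j \<and> j \<le> t \<and> j \<le> k j \<and> strict_mono_on {j..t} k \<and>
     a = (\<Sum>i=j..t. k i choose i)"

text \<open>\<open>macaulay_bound a t\<close> is \<open>a\<^sup>\<langle>\<^sup>t\<^sup>\<rangle>\<close>. The description is well defined for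
  \<open>a, t \<ge> 1\<close>, by existence and uniqueness of the binomial expansion; its value is
  not specified for \<open>a \<ge> 1\<close>, \<open>t = 0\<close>, which is never used below.\<close>

definition macaulay_bound :: "nat \<Rightarrow> nat \<Rightarrow> nat" where
  "macaulay_bound a t =
     (if a = 0 then 0
      else THE b. \<exists>j k. binomial_expansion a t j k \<and>
                        b = (\<Sum>i=j..t. (k i + 1) choose (i + 1)))"

definition O_sequence :: "(nat \<Rightarrow> nat) \<Rightarrow> bool" where
  "O_sequence h \<longleftrightarrow> h 0 = 1 \<and> (\<forall>t\<ge>1. h (t + 1) \<le> macaulay_bound (h t) t)"

definition finite_O_sequence :: "(nat \<Rightarrow> nat) \<Rightarrow> bool" where
  "finite_O_sequence h \<longleftrightarrow> O_sequence h \<and> (\<exists>t. h t = 0)"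

text \<open>Since \<open>macaulay_bound 0 t = 0\<close>, a finite O-sequence vanishes from its first zero
  on, so the first zero is the number \<open>s\<close> of entries in \<open>(h\<^sub>0, \<dots>, h\<^bsub>s-1\<^esub>)\<close> with
  \<open>h\<^bsub>s-1\<^esub> \<noteq> 0\<close>.\<close>

definition seq_length :: "(nat \<Rightarrow> nat) \<Rightarrow> nat" where
  "seq_length h = (LEAST t. h t = 0)"

definition seq_multiplicity :: "(nat \<Rightarrow> nat) \<Rightarrow> nat" where
  "seq_multiplicity h = (\<Sum>i<seq_length h. h i)"

definition genus :: "(nat \<Rightarrow> nat) \<Rightarrow> nat" where
  "genus h = (\<Sum>j=2..<seq_length h. (j - 1) * h j)"

definition genera :: "nat \<Rightarrow> nat set" where
  "genera d = {genus h | h. finite_O_sequence h \<and> seq_multiplicity h = d}"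

definition translate :: "nat set \<Rightarrow> nat \<Rightarrow> nat set" where
  "translate G a = {x + a | x. x \<in> G}"

end

theory Submission
  imports Defs
begin

text \<open>Put \<open>m = d - j\<close> and add \<open>1\<close> to the entries in degrees \<open>1, \<dots>, m\<close> of an O-sequence of
  multiplicity \<open>j\<close>: the multiplicity grows by \<open>m\<close> and the genus by
  \<open>0 + 1 + \<dots> + (m - 1)\<close>. The result is again an O-sequence because \<open>a \<mapsto> a\<^sup>\<langle>\<^sup>t\<^sup>\<rangle>\<close> is strictly
  increasing. For the latter, pad the binomial expansion by the vanishing terms \<open>(i - 1) choose i\<close>,
  so that it always runs over \<open>{1..t}\<close>; both \<open>a\<close> and \<open>a\<^sup>\<langle>\<^sup>t\<^sup>\<rangle>\<close> then order the expansions
  lexicographically from the top index.\<close>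

section \<open>Padded binomial expansions\<close>

text \<open>For a padded expansion, \<open>c = 0\<close> gives a and \<open>c = 1\<close> gives its
  Macaulay bound. Keeping \<open>c\<close> as a parameter lets one argument compare both.\<close>

definition shifted_sum :: "nat \<Rightarrow> nat \<Rightarrow> (nat \<Rightarrow> nat) \<Rightarrow> nat" where
  "shifted_sum c t k = (\<Sum>i=1..t. (k i + c) choose (i + c))"

lemma shifted_sum_0 [simp]: "shifted_sum c 0 k = 0"
  by (simp add: shifted_sum_def)

lemma shifted_sum_Suc [simp]:
  "shifted_sum c (Suc t) k = shifted_sum c t k + ((k (Suc t) + c) choose (Suc t + c))"
  by (simp add: shifted_sum_def)

lemma shifted_sum_cong:
  "(\<And>i. i \<in> {1..t} \<Longrightarrow> k i = l i) \<Longrightarrow> shifted_sum c t k = shifted_sum c t l"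
  by (simp add: shifted_sum_def)

lemma strict_mono_on_atLeastAtMost_Suc:
  fixes k :: "nat \<Rightarrow> nat"
  shows "strict_mono_on {1..Suc t} k \<longleftrightarrow>
    strict_mono_on {1..t} k \<and> (\<forall>i\<in>{1..t}. k i < k (Suc t))"
  by (auto simp: strict_mono_on_def le_Suc_eq)

text \<open>Pascal's rule adds up from the bottom: the terms below the top one total less than
  \<open>(K' + c) choose (t + c)\<close>, where \<open>K'\<close> is the top entry, so with the top
  term they stay below \<open>(K' + 1 + c) choose (t + 1 + c)\<close>.\<close>

lemma shifted_sum_less:
  assumes "strict_mono_on {1..t} k" "\<forall>i\<in>{1..t}. k i < K"
  shows "shifted_sum c t k < (K + c) choose (t + c)"
  using assms
proof (induction t arbitrary: K)
  case 0
  then show ?case by simp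
next
  case (Suc t)
  define K' where "K' = k (Suc t)"
  have K': "K' < K" using Suc.prems by (simp add: K'_def)
  have "strict_mono_on {1..t} k" "\<forall>i\<in>{1..t}. k i < K'"
    using Suc.prems(1) unfolding strict_mono_on_atLeastAtMost_Suc K'_def by blast+
  then have "shifted_sum c t k < (K' + c) choose (t + c)" using Suc.IH by blast
  then have "shifted_sum c (Suc t) k < Suc (K' + c) choose Suc (t + c)" by (simp add: K'_def)
  also have "\<dots> \<le> (K + c) choose (Suc t + c)"
    using K' binomial_right_mono[of "Suc (K' + c)" "K + c" "Suc (t + c)"] by simp
  finally show ?case .
qed

text \<open>The top term of \<open>l\<close> alone exceeds the whole sum of
  \<open>k\<close>.\<close>

lemma shifted_sum_less_if_last_less:
  assumes "strict_mono_on {1..Suc t} k" "k (Suc t) < l (Suc t)"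
  shows "shifted_sum c (Suc t) k < shifted_sum c (Suc t) l"
proof -
  have "\<forall>i\<in>{1..Suc t}. k i \<le> k (Suc t)"
    using strict_mono_on_leD[OF assms(1)] by simp
  then have "\<forall>i\<in>{1..Suc t}. k i < l (Suc t)"
    using assms(2) by (meson le_less_trans)
  from shifted_sum_less[OF assms(1) this, of c] show ?thesis by simp
qed

text \<open>The highest index where \<open>k\<close> and \<open>l\<close> differ decides the
  comparison independently of \<open>c\<close>. With \<open>c\<close> quantified inside each
  disjunct, an order observed for one shift carries over to every other.\<close>

lemma shifted_sum_trichotomy:
  assumes "strict_mono_on {1..t} k" "strict_mono_on {1..t} l"
  shows "(\<forall>i\<in>{1..t}. k i = l i) \<or> (\<forall>c. shifted_sum c t k < shifted_sum c t l) \<or>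
    (\<forall>c. shifted_sum c t l < shifted_sum c t k)"
  using assms
proof (induction t)
  case 0
  then show ?case by simp
next
  case (Suc t)
  consider "k (Suc t) < l (Suc t)" | "l (Suc t) < k (Suc t)" | "k (Suc t) = l (Suc t)"
    by linarith
  then show ?case
  proof cases
    case 1
    then show ?thesis using shifted_sum_less_if_last_less[OF Suc.prems(1)] by blast
  next
    case 2
    then show ?thesis using shifted_sum_less_if_last_less[OF Suc.prems(2)] by blast
  next
    case 3
    have "strict_mono_on {1..t} k" "strict_mono_on {1..t} l"
      using Suc.prems unfolding strict_mono_on_atLeastAtMost_Suc by blast+
    from Suc.IH[OF this] 3 show ?thesis by (auto simp: le_Suc_eq)
  qed
qed

lemma shifted_sum_eq_transfer:
  assumes "strict_mono_on {1..t} k" "strict_mono_on {1..t} l"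
    and "shifted_sum c t k = shifted_sum c t l"
  shows "shifted_sum c' t k = shifted_sum c' t l"
  using shifted_sum_trichotomy[OF assms(1,2)] assms(3)
  by (metis less_irrefl shifted_sum_cong)

lemma shifted_sum_less_transfer:
  assumes "strict_mono_on {1..t} k" "strict_mono_on {1..t} l"
    and "shifted_sum c t k < shifted_sum c t l"
  shows "shifted_sum c' t k < shifted_sum c' t l"
  using shifted_sum_trichotomy[OF assms(1,2)] assms(3)
  by (metis less_asym less_irrefl shifted_sum_cong)

text \<open>Greedy choice: the inner induction on \<open>K\<close> finds the largest top entry whose
  binomial does not exceed a. The bound on the entries keeps the remaining ones below that top
  entry.\<close>

lemma shifted_sum_0_exists_below:
  assumes "a < K choose t"
  shows "\<exists>k. strict_mono_on {1..t} k \<and> (\<forall>i\<in>{1..t}. k i < K) \<and> shifted_sum 0 t k = a"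
  using assms
proof (induction t arbitrary: a K)
  case 0
  then show ?case by simp
next
  case (Suc t)
  note IH = Suc.IH
  from Suc.prems show ?case
  proof (induction K)
    case 0
    then show ?case by simp
  next
    case (Suc K)
    show ?case
    proof (cases "a < K choose Suc t")
      case True
      then show ?thesis using Suc.IH less_SucI by metis
    next
      case False
      \<comment> \<open>Pascal's rule splits the bound on a, so the remainder fits the outer
        hypothesis with the same \<open>K\<close>.\<close>
      then have "a - (K choose Suc t) < K choose t" using Suc.prems by simp
      from IH[OF this] obtain k where k: "strict_mono_on {1..t} k" "\<forall>i\<in>{1..t}. k i < K"
        "shifted_sum 0 t k = a - (K choose Suc t)" by blast
      let ?k = "k(Suc t := K)"
      have "strict_mono_on {1..Suc t} ?k"
        using k(1,2) by (auto simp: strict_mono_on_atLeastAtMost_Suc strict_mono_on_def)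
      moreover have "\<forall>i\<in>{1..Suc t}. ?k i < Suc K" using k(2) by (auto simp: less_SucI)
      moreover have "shifted_sum 0 (Suc t) ?k = a"
        using k(3) False shifted_sum_cong[of t ?k k 0] by simp
      ultimately show ?thesis by blast
    qed
  qed
qed

lemma less_add_choose:
  assumes "1 \<le> t"
  shows "a < (a + t) choose t"
proof (induction a)
  case 0
  then show ?case by simp
next
  case (Suc a)
  obtain u where "t = Suc u" using assms by (cases t) auto
  moreover from this have "0 < (Suc a + u) choose u" by (simp add: zero_less_binomial)
  ultimately show ?case using Suc by (simp del: zero_less_binomial_iff)
qed

lemma shifted_sum_0_exists:
  assumes "1 \<le> t"
  obtains k where "strict_mono_on {1..t} k" "shifted_sum 0 t k = a"
  using shifted_sum_0_exists_below[OF less_add_choose[OF assms]] by blast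

section \<open>Macaulay's bound\<close>

lemma binomial_expansion_pad:
  assumes "binomial_expansion a t j k"
  obtains l where "strict_mono_on {1..t} l" "shifted_sum 0 t l = a"
    "shifted_sum 1 t l = (\<Sum>i=j..t. (k i + 1) choose (i + 1))"
proof -
  from assms have j: "1 \<le> j" "j \<le> t" "j \<le> k j" and mono: "strict_mono_on {j..t} k"
    and a: "a = (\<Sum>i=j..t. k i choose i)"
    by (auto simp: binomial_expansion_def)
  \<comment> \<open>Below \<open>j\<close> the terms \<open>(i - 1 + c) choose (i + c)\<close>
    vanish for every \<open>c\<close>. Monotonicity survives at the seam, since the padding stays
    below \<open>j\<close> and all later entries are at least \<open>j\<close>.\<close>
  define l where "l i = (if i < j then i - 1 else k i)" for i
  have ge: "j \<le> k i" if "j \<le> i" "i \<le> t" for i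
    using strict_mono_on_leD[OF mono, of j i] that j by simp
  have l_mono: "strict_mono_on {1..t} l"
  proof (rule strict_mono_onI)
    fix r s assume "r \<in> {1..t}" "s \<in> {1..t}" "r < s"
    then show "l r < l s"
      using ge[of s] strict_mono_onD[OF mono, of r s] by (auto simp: l_def)
  qed
  have sum: "shifted_sum c t l = (\<Sum>i=j..t. (k i + c) choose (i + c))" for c
    unfolding shifted_sum_def
    by (rule sum.mono_neutral_cong_right) (use j in \<open>auto simp: l_def\<close>)
  show thesis using that[OF l_mono] sum[of 0] sum[of 1] a by simp
qed

lemma binomial_expansion_unpad:
  assumes l: "strict_mono_on {1..t} l" and "shifted_sum 0 t l \<noteq> 0"
  obtains j where "binomial_expansion (shifted_sum 0 t l) t j l"
    "shifted_sum 1 t l = (\<Sum>i=j..t. (l i + 1) choose (i + 1))"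
proof -
  define P where "P i \<longleftrightarrow> i \<in> {1..t} \<and> i \<le> l i" for i
  \<comment> \<open>The expansion starts at the first index with a nonzero term; everything below it
    is padding.\<close>
  define j where "j = (LEAST i. P i)"
  have "\<exists>i. P i"
  proof (rule ccontr)
    assume "\<nexists>i. P i"
    then have "shifted_sum 0 t l = 0" by (auto simp: shifted_sum_def P_def)
    with assms(2) show False by simp
  qed
  then have "P j" unfolding j_def by (rule LeastI_ex)
  have below: "l i < i" if "i \<in> {1..t}" "i < j" for i
    using that not_less_Least[of i P] by (auto simp: j_def P_def)
  have sum: "shifted_sum c t l = (\<Sum>i=j..t. (l i + c) choose (i + c))" for c
    unfolding shifted_sum_def
    by (rule sum.mono_neutral_right) (use \<open>P j\<close> below in \<open>auto simp: P_def\<close>)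
  have "strict_mono_on {j..t} l"
    using l \<open>P j\<close> by (auto simp: strict_mono_on_def P_def)
  then have "binomial_expansion (shifted_sum 0 t l) t j l"
    using \<open>P j\<close> sum[of 0] by (simp add: binomial_expansion_def P_def)
  then show thesis using that sum by blast
qed

lemma macaulay_bound_shifted_sum:
  assumes l: "strict_mono_on {1..t} l"
  shows "macaulay_bound (shifted_sum 0 t l) t = shifted_sum 1 t l"
proof (cases "shifted_sum 0 t l = 0")
  case True
  then have "shifted_sum 1 t l = 0" by (auto simp: shifted_sum_def)
  with True show ?thesis by (simp add: macaulay_bound_def)
next
  case False
  have "(THE b. \<exists>j k. binomial_expansion (shifted_sum 0 t l) t j k \<and>
          b = (\<Sum>i=j..t. (k i + 1) choose (i + 1))) = shifted_sum 1 t l"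
  proof (rule the_equality)
    show "\<exists>j k. binomial_expansion (shifted_sum 0 t l) t j k \<and>
        shifted_sum 1 t l = (\<Sum>i=j..t. (k i + 1) choose (i + 1))"
      using binomial_expansion_unpad[OF l False] by metis
  next
    fix b
    assume "\<exists>j k. binomial_expansion (shifted_sum 0 t l) t j k \<and>
        b = (\<Sum>i=j..t. (k i + 1) choose (i + 1))"
    then obtain l' where "strict_mono_on {1..t} l'"
      "shifted_sum 0 t l' = shifted_sum 0 t l" "shifted_sum 1 t l' = b"
      using binomial_expansion_pad by metis
    \<comment> \<open>Two padded expansions of the same number have equal sums for every shift, so
      \<open>THE\<close> is well defined.\<close>
    then show "b = shifted_sum 1 t l" using shifted_sum_eq_transfer l by blast
  qed
  with False show ?thesis by (simp add: macaulay_bound_def)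
qed

lemma macaulay_bound_strict_mono:
  assumes "1 \<le> t" "a < b"
  shows "macaulay_bound a t < macaulay_bound b t"
proof -
  obtain k l where "strict_mono_on {1..t} k" "shifted_sum 0 t k = a"
    and "strict_mono_on {1..t} l" "shifted_sum 0 t l = b"
    using shifted_sum_0_exists[OF assms(1)] by metis
  with assms(2) show ?thesis
    using macaulay_bound_shifted_sum shifted_sum_less_transfer by metis
qed

section \<open>Finite O-sequences\<close>

lemma finite_O_sequence_zero_mono:
  assumes "finite_O_sequence h" "h t = 0" "t \<le> u"
  shows "h u = 0"
  using assms(3)
proof (induction u rule: dec_induct)
  case base
  show ?case by fact
next
  case (step n)
  have h: "O_sequence h" using assms(1) by (simp add: finite_O_sequence_def)
  \<comment> \<open>The growth condition only starts in degree 1; degree 0 is excluded by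
    \<open>h 0 = 1\<close>.\<close>
  then have "n \<noteq> 0" using step.IH by (intro notI) (simp add: O_sequence_def)
  then have "h (n + 1) \<le> macaulay_bound (h n) n" using h by (simp add: O_sequence_def)
  then show ?case using step.IH by (simp add: macaulay_bound_def)
qed

lemma seq_length_le_iff:
  assumes "finite_O_sequence h"
  shows "seq_length h \<le> N \<longleftrightarrow> h N = 0"
proof
  have "h (seq_length h) = 0"
    using assms LeastI_ex[of "\<lambda>t. h t = 0"]
    unfolding seq_length_def finite_O_sequence_def by blast
  then show "seq_length h \<le> N \<Longrightarrow> h N = 0"
    using finite_O_sequence_zero_mono[OF assms] by blast
qed (simp add: seq_length_def Least_le)

lemma seq_multiplicity_eq_sum:
  assumes "finite_O_sequence h" "h N = 0"
  shows "seq_multiplicity h = (\<Sum>i<N. h i)"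
  unfolding seq_multiplicity_def
  using assms(2) unfolding seq_length_le_iff[OF assms(1), symmetric]
  by (intro sum.mono_neutral_left)
    (auto simp: seq_length_le_iff[OF assms(1), symmetric] not_less)

text \<open>Starting at 0 is harmless: truncated subtraction makes the weights at 0 and 1 vanish. A
  free \<open>N\<close> gives two sequences a common range.\<close>

lemma genus_eq_sum:
  assumes "finite_O_sequence h" "h N = 0"
  shows "genus h = (\<Sum>i<N. (i - 1) * h i)"
  unfolding genus_def
  using assms(2) unfolding seq_length_le_iff[OF assms(1), symmetric]
  by (intro sum.mono_neutral_left)
    (auto simp: seq_length_le_iff[OF assms(1), symmetric] not_less)

definition add_ones :: "nat \<Rightarrow> (nat \<Rightarrow> nat) \<Rightarrow> nat \<Rightarrow> nat" where
  "add_ones m h t = h t + (if t \<in> {1..m} then 1 else 0)"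

lemma O_sequence_add_ones:
  assumes "O_sequence h"
  shows "O_sequence (add_ones m h)"
  unfolding O_sequence_def
proof (intro conjI allI impI)
  show "add_ones m h 0 = 1" using assms by (simp add: O_sequence_def add_ones_def)
next
  fix t :: nat
  assume t: "1 \<le> t"
  then have *: "h (t + 1) \<le> macaulay_bound (h t) t" using assms by (simp add: O_sequence_def)
  show "add_ones m h (t + 1) \<le> macaulay_bound (add_ones m h t) t"
  proof (cases "t \<le> m")
    case True
    have "add_ones m h (t + 1) \<le> h (t + 1) + 1" by (simp add: add_ones_def)
    \<comment> \<open>Raising the argument by 1 raises the bound by at least 1, which pays for the
      added 1 in degree \<open>t + 1\<close>.\<close>
    also have "\<dots> \<le> macaulay_bound (h t + 1) t"
      using * macaulay_bound_strict_mono[OF t, of "h t" "h t + 1"] by simp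
    finally show ?thesis using True t by (simp add: add_ones_def)
  next
    case False
    then show ?thesis using * by (simp add: add_ones_def)
  qed
qed

lemma sum_diff_1_eq_choose_2: "(\<Sum>i=1..m. i - 1) = m choose 2" for m :: nat
  by (induction m) (auto simp: numeral_2_eq_2)

lemma add_ones_invariants:
  assumes "finite_O_sequence h"
  shows "finite_O_sequence (add_ones m h)"
    and "seq_multiplicity (add_ones m h) = seq_multiplicity h + m"
    and "genus (add_ones m h) = genus h + (m choose 2)"
proof -
  \<comment> \<open>Past both the end of \<open>h\<close> and degree \<open>m\<close>, so both
    sequences vanish at \<open>N\<close> and every added 1 lies in the range.\<close>
  define N where "N = max (seq_length h) (Suc m)"
  have hN: "h N = 0" by (rule iffD1[OF seq_length_le_iff[OF assms]]) (simp add: N_def)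
  then have N: "add_ones m h N = 0" by (simp add: add_ones_def N_def)
  show fin: "finite_O_sequence (add_ones m h)"
    using assms O_sequence_add_ones N by (auto simp: finite_O_sequence_def)
  have int: "{..<N} \<inter> {1..m} = {1..m}" by (auto simp: N_def)
  show "seq_multiplicity (add_ones m h) = seq_multiplicity h + m"
    unfolding seq_multiplicity_eq_sum[OF fin N] seq_multiplicity_eq_sum[OF assms hN]
    by (simp add: add_ones_def sum.distrib int flip: sum.inter_restrict del: atLeastAtMost_iff One_nat_def)
  have "genus (add_ones m h) =
      (\<Sum>i<N. (i - 1) * h i) + (\<Sum>i<N. if i \<in> {1..m} then i - 1 else 0)"
    unfolding genus_eq_sum[OF fin N] sum.distrib[symmetric]
    by (rule sum.cong) (auto simp: add_ones_def distrib_left)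
  then show "genus (add_ones m h) = genus h + (m choose 2)"
    unfolding genus_eq_sum[OF assms hN]
    by (simp add: int sum_diff_1_eq_choose_2 flip: sum.inter_restrict
      del: atLeastAtMost_iff One_nat_def)
qed

theorem lemma5p1:
  fixes d :: nat
  assumes "d > 0"
  shows "(\<Union>j\<in>{1..d-1}. translate (genera j) ((d - j) choose 2)) \<subseteq> genera d"
proof
  fix g
  assume "g \<in> (\<Union>j\<in>{1..d-1}. translate (genera j) ((d - j) choose 2))"
  then obtain j h where "j \<in> {1..d-1}" and g: "g = genus h + ((d - j) choose 2)"
    and h: "finite_O_sequence h" "seq_multiplicity h = j"
    unfolding translate_def genera_def by blast
  \<comment> \<open>Here \<open>j < d\<close>, so the subtraction does not truncate.\<close>
  then have "j + (d - j) = d" by auto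
  then have "finite_O_sequence (add_ones (d - j) h)" "seq_multiplicity (add_ones (d - j) h) = d"
    "genus (add_ones (d - j) h) = g"
    using add_ones_invariants[OF h(1), of "d - j"] h(2) g by simp_all
  then show "g \<in> genera d" unfolding genera_def by blast
qed

end
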